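(* For all integers $\Delta,t\geq 1$ and every $\varepsilon>0$, there is a finite connected graph $G$ with maximum degree $\Delta$ satisfying $$\textit{VR}(G,t)\geq 1-\frac{1}{\Delta}-\varepsilon.$$
   Context: The discrete Voronoi game on a finite graph $G$ with $t$ rounds: two players $\mathbf{A}$ and $\mathbf{B}$ alternately claim vertices of $G$, $\mathbf{A}$ first, each player claiming one vertex per round, for $t$ rounds (no vertex may be claimed twice). Distances are shortest-path distances in $G$. At the end, each vertex strictly closer to the set of $\mathbf{A}$'s claimed vertices than to the set of $\mathbf{B}$'s claimed vertices belongs to $\mathbf{A}$, each vertex strictly closer to $\mathbf{B}$'s set belongs to $\mathbf{B}$, and each vertex at equal distance is tied (each player receives half of it). The Voronoi ratio $\textit{VR}(G,t)$ is the number of vertices belonging to $\mathbf{A}$ plus half the number of tied vertices, divided by $|V(G)|$, when both players play optimally ($\mathbf{A}$ maximizing, $\mathbf{B}$ minimizing). *)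

theory Defs
  imports Complex_Main "Graph_Theory.Graph_Theory"
begin

text \<open>
  A finite simple undirected graph is a \<open>pair_graph\<close>: finite vertex set, symmetric loop-free
  set of arcs. The degree of a vertex is then its out-degree.
\<close>

definition max_degree :: "'a pair_pre_digraph \<Rightarrow> nat" where
  "max_degree G = Max (out_degree (with_proj G) ` pverts G)"

definition vdist :: "'a pair_pre_digraph \<Rightarrow> 'a \<Rightarrow> 'a \<Rightarrow> ereal" where
  "vdist G u v = wf_digraph.\<mu> (with_proj G) (\<lambda>_. 1) u v"

definition vsetdist :: "'a pair_pre_digraph \<Rightarrow> 'a \<Rightarrow> 'a set \<Rightarrow> ereal" where
  "vsetdist G v S = (INF s\<in>S. vdist G v s)"

definition voronoi_score :: "'a pair_pre_digraph \<Rightarrow> 'a set \<Rightarrow> 'a set \<Rightarrow> real" where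
  "voronoi_score G A B =
     real (card {v \<in> pverts G. vsetdist G v A < vsetdist G v B}) +
     real (card {v \<in> pverts G. vsetdist G v A = vsetdist G v B}) / 2"

text \<open>
  Minimax value of the position in which the players have claimed \<open>A\<close> and \<open>B\<close>.
  In \<open>value_A G k A B\<close> it is the first player's turn and \<open>k\<close> full rounds remain; in
  \<open>value_B G k A B\<close> it is the second player's turn and \<open>k\<close> full rounds remain after this move.
  If all vertices are claimed before the last round, the game ends at that point.
\<close>

fun value_A :: "'a pair_pre_digraph \<Rightarrow> nat \<Rightarrow> 'a set \<Rightarrow> 'a set \<Rightarrow> real"
  and value_B :: "'a pair_pre_digraph \<Rightarrow> nat \<Rightarrow> 'a set \<Rightarrow> 'a set \<Rightarrow> real" where
  "value_A G 0 A B = voronoi_score G A B"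
| "value_A G (Suc k) A B =
     (if pverts G - (A \<union> B) = {} then voronoi_score G A B
      else Max ((\<lambda>v. value_B G k (insert v A) B) ` (pverts G - (A \<union> B))))"
| "value_B G k A B =
     (if pverts G - (A \<union> B) = {} then voronoi_score G A B
      else Min ((\<lambda>v. value_A G k A (insert v B)) ` (pverts G - (A \<union> B))))"

definition voronoi_ratio :: "'a pair_pre_digraph \<Rightarrow> nat \<Rightarrow> real" where
  "voronoi_ratio G t = value_A G t {} {} / real (card (pverts G))"

end

theory Submission
  imports Defs "HOL-Library.Nat_Bijection" "HOL-Real_Asymp.Real_Asymp"
begin

text \<open>
  For \<open>\<Delta> \<ge> 3\<close> the graph is a comb: \<open>\<Delta>\<close> rays start from a hub, and each ray carries \<open>m\<close> teeth,
  pendant paths attached at exponentially growing distances from the hub and so long that they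
  contain almost all vertices. The first player claims the hub and then answers every claim on a
  ray by a nearby vertex of the same ray further away from the hub. The answer cuts the claim off
  from the teeth attached beyond it, while the teeth attached at less than half the distance of the
  claim are closer to the hub; since the distances grow exponentially, an answered claim wins at
  most one tooth. Only the last claim stays unanswered, and it wins at most its ray, a fraction
  \<open>1 / \<Delta>\<close> of the graph.

  If \<open>\<Delta> = 1\<close> or \<open>t = 1\<close>, a star suffices. For \<open>\<Delta> = 2\<close> and \<open>t \<ge> 2\<close>, a path with \<open>2 * t\<close> vertices
  does, because all its vertices are claimed.
\<close>

section \<open>Distances\<close>

context pair_wf_digraph
begin

lemma awalk_cost_unit: "awalk_cost (\<lambda>_. 1) p = real (length p)"
  by (induction p) auto

lemma vdist_conv_length: "vdist G u v = (INF p\<in>{p. awalk u p v}. ereal (length p))"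
  by (simp add: vdist_def \<mu>_def awalk_cost_unit)

lemma vdist_le_length: "awalk u p v \<Longrightarrow> vdist G u v \<le> ereal (length p)"
  unfolding vdist_conv_length by (auto intro: INF_lower)

lemma vdist_nonneg: "0 \<le> vdist G u v"
  unfolding vdist_conv_length by (intro INF_greatest) auto

lemma vdist_less_infinity: "u \<rightarrow>\<^sup>*\<^bsub>with_proj G\<^esub> v \<Longrightarrow> vdist G u v < \<infinity>"
  unfolding vdist_def \<mu>_reach_conv .

lemma potential_le_vdist:
  fixes \<phi> :: "'a \<Rightarrow> real"
  assumes "\<And>u v. (u, v) \<in> parcs G \<Longrightarrow> \<phi> v \<le> \<phi> u + 1"
  shows "ereal (\<phi> v - \<phi> u) \<le> vdist G u v"
proof -
  have "\<phi> v \<le> \<phi> u + real (length p)" if "awalk u p v" for u p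
    using that
  proof (induction p arbitrary: u)
    case Nil
    then show ?case by (simp add: awalk_Nil_iff)
  next
    case (Cons e p)
    then have "e \<in> parcs G" "fst e = u" "awalk (snd e) p v"
      by (auto simp: awalk_Cons_iff)
    with Cons.IH[of "snd e"] assms[of u "snd e"] show ?case
      by (cases e) auto
  qed
  then show ?thesis
    unfolding vdist_conv_length by (intro INF_greatest) (auto simp: algebra_simps)
qed

lemma awalk_prefix_to_cut_vertex:
  assumes "awalk v p w" "v \<in> S" "w \<notin> S"
    and cut: "\<And>x y. (x, y) \<in> parcs G \<Longrightarrow> x \<in> S \<Longrightarrow> y \<notin> S \<Longrightarrow> x = c"
  obtains q where "awalk v q c" "length q < length p"
proof -
  have "\<exists>q. awalk v q c \<and> length q < length p"
    using assms(1,2)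
  proof (induction p arbitrary: v)
    case Nil
    then show ?case using assms(3) by (simp add: awalk_Nil_iff)
  next
    case (Cons e p)
    then obtain y where e: "e = (v, y)" "(v, y) \<in> parcs G" "awalk y p w"
      by (cases e) (auto simp: awalk_Cons_iff)
    show ?case
    proof (cases "y \<in> S")
      case True
      then obtain q where "awalk y q c" "length q < length p"
        using Cons.IH e(3) by blast
      then show ?thesis
        using e(2) by (intro exI[of _ "(v, y) # q"]) (simp add: awalk_Cons_iff)
    next
      case False
      then have "awalk v [] c"
        using cut e(2) Cons.prems by (auto simp: awalk_Nil_iff)
      then show ?thesis by (intro exI[of _ "[]"]) simp
    qed
  qed
  then show ?thesis using that by blast
qed

lemma vdist_cut_vertex_less:
  assumes "v \<in> S" "w \<notin> S" "v \<rightarrow>\<^sup>*\<^bsub>with_proj G\<^esub> c"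
    and cut: "\<And>x y. (x, y) \<in> parcs G \<Longrightarrow> x \<in> S \<Longrightarrow> y \<notin> S \<Longrightarrow> x = c"
  shows "vdist G v c < vdist G v w"
proof -
  obtain d where d: "vdist G v c = ereal d"
    using vdist_nonneg[of v c] vdist_less_infinity[OF assms(3)] by (cases "vdist G v c") auto
  have "ereal (d + 1) \<le> ereal (length p)" if walk: "awalk v p w" for p
  proof -
    obtain q where "awalk v q c" "length q < length p"
      using awalk_prefix_to_cut_vertex[OF walk assms(1,2) cut] .
    with vdist_le_length[of v q c] d show ?thesis by simp
  qed
  then have "ereal (d + 1) \<le> vdist G v w"
    unfolding vdist_conv_length by (intro INF_greatest) auto
  with d show ?thesis by (cases "vdist G v w") auto
qed

lemma vdist_self_less:
  assumes "v \<in> pverts G" "v \<noteq> w"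
  shows "vdist G v v < vdist G v w"
  using assms by (intro vdist_cut_vertex_less[of v "{v}"]) auto

end

lemma vsetdist_lessI:
  assumes "finite B" "a\<^sub>0 \<in> A" "vdist G v a\<^sub>0 < \<infinity>"
    and closer: "\<And>b. b \<in> B \<Longrightarrow> \<exists>a\<in>A. vdist G v a < vdist G v b"
  shows "vsetdist G v A < vsetdist G v B"
proof (cases "B = {}")
  case True
  have "vsetdist G v A \<le> vdist G v a\<^sub>0"
    unfolding vsetdist_def using assms(2) by (rule INF_lower)
  also have "\<dots> < vsetdist G v B"
    using assms(3) True by (simp add: vsetdist_def top_ereal_def)
  finally show ?thesis .
next
  case False
  have "vsetdist G v A < vdist G v b" if "b \<in> B" for b
    using closer[OF that] unfolding vsetdist_def by (simp add: INF_less_iff)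
  with False assms(1) show ?thesis
    by (simp add: vsetdist_def[of G v B] finite_less_Inf_iff)
qed

section \<open>The game\<close>

lemma voronoi_score_nonneg: "0 \<le> voronoi_score G A B"
  by (simp add: voronoi_score_def)

lemma card_le_voronoi_score:
  assumes "finite (pverts G)" "S \<subseteq> pverts G"
    and "\<And>v. v \<in> S \<Longrightarrow> vsetdist G v A < vsetdist G v B"
  shows "real (card S) \<le> voronoi_score G A B"
proof -
  have "card S \<le> card {v \<in> pverts G. vsetdist G v A < vsetdist G v B}"
    using assms by (intro card_mono) auto
  then show ?thesis
    unfolding voronoi_score_def by (simp add: add_increasing2)
qed

lemma value_nonneg:
  assumes "finite (pverts G)"
  shows "0 \<le> value_A G k A B" and "0 \<le> value_B G k A B"
  using assms
proof (induction G k A B and G k A B rule: value_A_value_B.induct)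
  case (2 G k A B)
  then show ?case
    by (auto simp: Max_ge_iff voronoi_score_nonneg simp del: value_B.simps)
qed (auto simp: Min_ge_iff voronoi_score_nonneg)

lemma voronoi_ratio_nonneg: "finite (pverts G) \<Longrightarrow> 0 \<le> voronoi_ratio G t"
  by (simp add: voronoi_ratio_def value_nonneg)

lemma value_B_le_value_A:
  assumes "finite (pverts G)" "v \<in> pverts G - (A \<union> B)"
  shows "value_B G k (insert v A) B \<le> value_A G (Suc k) A B"
  using assms by (auto simp del: value_B.simps intro!: Max_ge)

lemma le_value_B:
  assumes "finite (pverts G)" "\<not> pverts G \<subseteq> A \<union> B"
    and "\<And>v. v \<in> pverts G - (A \<union> B) \<Longrightarrow> s \<le> value_A G k A (insert v B)"
  shows "s \<le> value_B G k A B"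
  using assms by (auto simp: Min_ge_iff)

definition position :: "'a pair_pre_digraph \<Rightarrow> nat \<Rightarrow> nat \<Rightarrow> 'a set \<Rightarrow> 'a set \<Rightarrow> bool" where
  "position G a b A B \<longleftrightarrow> finite (pverts G) \<and> A \<subseteq> pverts G \<and> B \<subseteq> pverts G \<and> A \<inter> B = {} \<and>
     card A = a \<and> card B = b"

lemma position_finite:
  assumes "position G a b A B"
  shows "finite A" "finite B"
  using assms by (auto simp: position_def intro: finite_subset)

lemma position_empty_iff:
  assumes "position G a b A B"
  shows "A = {} \<longleftrightarrow> a = 0" "B = {} \<longleftrightarrow> b = 0"
  using assms position_finite[OF assms] by (auto simp: position_def)

lemma position_claim_A:
  assumes "position G a b A B" "v \<in> pverts G - (A \<union> B)"
  shows "position G (Suc a) b (insert v A) B"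
  using assms position_finite[OF assms(1)] by (auto simp: position_def)

lemma position_claim_B:
  assumes "position G a b A B" "v \<in> pverts G - (A \<union> B)"
  shows "position G a (Suc b) A (insert v B)"
  using assms position_finite[OF assms(1)] by (auto simp: position_def)

lemma position_not_full:
  assumes "position G a b A B" "a + b < card (pverts G)"
  shows "\<not> pverts G \<subseteq> A \<union> B"
proof
  assume "pverts G \<subseteq> A \<union> B"
  then have "card (pverts G) \<le> card (A \<union> B)"
    using position_finite[OF assms(1)] by (intro card_mono) auto
  also have "\<dots> \<le> a + b"
    using assms(1) card_Un_le[of A B] by (simp add: position_def)
  finally show False using assms(2) by simp
qed

lemma le_value_A_strategy:
  assumes "finite (pverts G)" "2 * t \<le> card (pverts G)" "P {} {}"
    and move: "\<And>k A B. k < t \<Longrightarrow> position G k k A B \<Longrightarrow> P A B \<Longrightarrow>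
      \<exists>v \<in> pverts G - (A \<union> B). Q (insert v A) B"
    and reply: "\<And>k A B v. k < t \<Longrightarrow> position G (Suc k) k A B \<Longrightarrow> Q A B \<Longrightarrow>
      v \<in> pverts G - (A \<union> B) \<Longrightarrow> P A (insert v B)"
    and final: "\<And>A B. position G t t A B \<Longrightarrow> P A B \<Longrightarrow> s \<le> voronoi_score G A B"
  shows "s \<le> value_A G t {} {}"
proof -
  have "s \<le> value_A G k A B" if "position G j j A B" "P A B" "j + k = t" for j k A B
    using that
  proof (induction k arbitrary: j A B)
    case 0
    then show ?case using final by simp
  next
    case (Suc k)
    then obtain v where v: "v \<in> pverts G - (A \<union> B)" "Q (insert v A) B"
      using move[of j A B] by auto
    with Suc.prems(1) have pos: "position G (Suc j) j (insert v A) B"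
      by (intro position_claim_A)
    have "s \<le> value_B G k (insert v A) B"
    proof (rule le_value_B)
      show "\<not> pverts G \<subseteq> insert v A \<union> B"
        using position_not_full[OF pos] Suc.prems(3) assms(2) by simp
      fix w
      assume w: "w \<in> pverts G - (insert v A \<union> B)"
      show "s \<le> value_A G k (insert v A) (insert w B)"
        using position_claim_B[OF pos w] reply[OF _ pos v(2) w] Suc.prems(3)
        by (intro Suc.IH[of "Suc j"]) auto
    qed fact
    also have "\<dots> \<le> value_A G (Suc k) A B"
      using assms(1) v(1) by (rule value_B_le_value_A)
    finally show ?case .
  qed
  then show ?thesis
    using assms(1,3) by (auto simp: position_def)
qed

lemma (in pair_graph) rounds_le_value_A:
  assumes "2 * t \<le> card (pverts G)"
  shows "real t \<le> value_A G t {} {}"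
proof (rule le_value_A_strategy[where P = "\<lambda>_ _. True" and Q = "\<lambda>_ _. True"])
  fix A B
  assume pos: "position G t t A B"
  have "real (card A) \<le> voronoi_score G A B"
  proof (rule card_le_voronoi_score)
    fix v
    assume "v \<in> A"
    then have v: "v \<in> pverts G" "v \<notin> B"
      using pos by (auto simp: position_def)
    show "vsetdist G v A < vsetdist G v B"
    proof (rule vsetdist_lessI)
      show "finite B" using pos by (rule position_finite)
      show "v \<in> A" by fact
      show "vdist G v v < \<infinity>" using v by (intro vdist_less_infinity) simp
      show "\<exists>a\<in>A. vdist G v a < vdist G v b" if "b \<in> B" for b
        using that v \<open>v \<in> A\<close> vdist_self_less[of v b] by blast
    qed
  qed (use pos in \<open>auto simp: position_def\<close>)
  then show "real t \<le> voronoi_score G A B"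
    using pos by (simp add: position_def)
next
  fix k A B
  assume "k < t" and pos: "position G k k A B"
  with assms have "\<not> pverts G \<subseteq> A \<union> B"
    by (intro position_not_full) auto
  then show "\<exists>v\<in>pverts G - (A \<union> B). True" by blast
qed (use assms in auto)

section \<open>Rooted trees\<close>

lemma out_degree_eq_card_neighbours:
  "out_degree (with_proj G) u = card {v. (u, v) \<in> parcs G}"
proof -
  have "out_arcs (with_proj G) u = Pair u ` {v. (u, v) \<in> parcs G}"
    by (auto simp: out_arcs_def)
  then show ?thesis
    by (simp add: out_degree_def card_image inj_on_def)
qed

lemma max_degree_eqI:
  assumes "finite (pverts G)" "u \<in> pverts G" "out_degree (with_proj G) u = d"
    and "\<And>v. v \<in> pverts G \<Longrightarrow> out_degree (with_proj G) v \<le> d"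
  shows "max_degree G = d"
  unfolding max_degree_def using assms by (intro Max_eqI) auto

definition parent_graph :: "'a set \<Rightarrow> 'a \<Rightarrow> ('a \<Rightarrow> 'a) \<Rightarrow> 'a pair_pre_digraph" where
  "parent_graph V r p =
     \<lparr>pverts = V, parcs = (\<lambda>u. (u, p u)) ` (V - {r}) \<union> (\<lambda>u. (p u, u)) ` (V - {r})\<rparr>"

lemma pverts_parent_graph [simp]: "pverts (parent_graph V r p) = V"
  by (simp add: parent_graph_def)

lemma parcs_parent_graph:
  "(u, v) \<in> parcs (parent_graph V r p) \<longleftrightarrow>
     u \<in> V \<and> u \<noteq> r \<and> v = p u \<or> v \<in> V \<and> v \<noteq> r \<and> u = p v"
  by (auto simp: parent_graph_def)

locale rooted_tree =
  fixes V :: "'a set" and r :: 'a and p :: "'a \<Rightarrow> 'a" and depth :: "'a \<Rightarrow> nat"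
  assumes finite_V: "finite V" and root_in_V: "r \<in> V"
    and parent_in_V: "\<And>u. u \<in> V \<Longrightarrow> u \<noteq> r \<Longrightarrow> p u \<in> V"
    and depth_parent: "\<And>u. u \<in> V \<Longrightarrow> u \<noteq> r \<Longrightarrow> depth (p u) < depth u"
begin

abbreviation G :: "'a pair_pre_digraph" where
  "G \<equiv> parent_graph V r p"

lemma pair_graph_tree: "pair_graph G"
proof
  fix e
  assume e: "e \<in> parcs G"
  show "fst e \<in> pverts G" "snd e \<in> pverts G"
    using e by (auto simp: parent_graph_def intro: parent_in_V)
  show "fst e \<noteq> snd e"
    using e depth_parent by (force simp: parent_graph_def)
next
  show "finite (pverts G)" "finite (parcs G)"
    using finite_V by (auto simp: parent_graph_def)
  show "symmetric (with_proj G)"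
    by (auto simp: symmetric_def sym_def parcs_parent_graph)
qed

sublocale pair_graph G
  by (rule pair_graph_tree)

lemma awalk_to_root:
  assumes "u \<in> V"
  shows "\<exists>q. awalk u q r \<and> length q \<le> depth u"
  using assms
proof (induction "depth u" arbitrary: u rule: less_induct)
  case less
  show ?case
  proof (cases "u = r")
    case True
    then show ?thesis
      using root_in_V by (intro exI[of _ "[]"]) (simp add: awalk_Nil_iff)
  next
    case False
    then obtain q where "awalk (p u) q r" "length q \<le> depth (p u)"
      using less parent_in_V depth_parent by blast
    then show ?thesis
      using False less.prems depth_parent[of u]
      by (intro exI[of _ "(u, p u) # q"]) (auto simp: awalk_Cons_iff parcs_parent_graph)
  qed
qed

lemma vdist_root_le_depth: "u \<in> V \<Longrightarrow> vdist G u r \<le> ereal (depth u)"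
  using awalk_to_root[of u] vdist_le_length by (force intro: order_trans)

lemma reachable_tree:
  assumes "u \<in> V" "v \<in> V"
  shows "u \<rightarrow>\<^sup>*\<^bsub>with_proj G\<^esub> v"
proof -
  have "u \<rightarrow>\<^sup>*\<^bsub>with_proj G\<^esub> r" "v \<rightarrow>\<^sup>*\<^bsub>with_proj G\<^esub> r"
    using assms awalk_to_root by (auto simp: reachable_awalk)
  then show ?thesis
    using symmetric_reachable' reachable_trans by blast
qed

lemma connected_tree: "Digraph_Component.connected (with_proj G)"
proof -
  have "u \<rightarrow>\<^sup>*\<^bsub>with_proj (mk_symmetric (with_proj G))\<^esub> v" if "u \<in> V" "v \<in> V" for u v
    using reachable_tree[OF that] sym_arcs by (simp add: reachable_mk_symmetric_eq)
  then show ?thesis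
    using root_in_V unfolding connected_def strongly_connected_def by auto
qed

lemma potential_le_vdist_tree:
  fixes \<phi> :: "'a \<Rightarrow> real"
  assumes "\<And>u. u \<in> V \<Longrightarrow> u \<noteq> r \<Longrightarrow> \<bar>\<phi> u - \<phi> (p u)\<bar> \<le> 1"
  shows "ereal (\<phi> v - \<phi> u) \<le> vdist G u v"
proof (rule potential_le_vdist)
  fix u v
  assume "(u, v) \<in> parcs G"
  then show "\<phi> v \<le> \<phi> u + 1"
    using assms[of u] assms[of v] by (auto simp: parcs_parent_graph)
qed

definition children :: "'a \<Rightarrow> 'a set" where
  "children u = {v \<in> V. v \<noteq> r \<and> p v = u}"

lemma out_degree_tree:
  assumes "u \<in> V"
  shows "out_degree (with_proj G) u = card (children u) + of_bool (u \<noteq> r)"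
proof -
  have nbrs: "{v. (u, v) \<in> parcs G} = children u \<union> (if u = r then {} else {p u})"
    using assms by (auto simp: parcs_parent_graph children_def)
  have "p u \<notin> children u" if "u \<noteq> r"
    using depth_parent[OF assms that] depth_parent[of "p u"] by (auto simp: children_def)
  moreover have "finite (children u)"
    using finite_V by (simp add: children_def)
  ultimately show ?thesis
    by (simp add: out_degree_eq_card_neighbours nbrs)
qed

end

section \<open>Stars and paths\<close>

abbreviation star_graph :: "nat \<Rightarrow> nat pair_pre_digraph" where
  "star_graph n \<equiv> parent_graph {..n} 0 (\<lambda>_. 0)"

interpretation star: rooted_tree "{..n}" 0 "\<lambda>_. 0" id for n :: nat
  by unfold_locales auto

lemma max_degree_star_graph: "max_degree (star_graph n) = n"
proof (rule max_degree_eqI)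
  have children: "star.children n u = (if u = 0 then {1..n} else {})" for u
    by (auto simp: star.children_def)
  show "out_degree (with_proj (star_graph n)) 0 = n"
    by (simp add: star.out_degree_tree children)
  show "out_degree (with_proj (star_graph n)) v \<le> n" if "v \<in> pverts (star_graph n)" for v
    using that by (simp add: star.out_degree_tree children)
qed auto

lemma star_graph_won:
  assumes "v \<in> {..n} - {b}" "b \<noteq> 0"
  shows "vsetdist (star_graph n) v {0} < vsetdist (star_graph n) v {b}"
proof (rule vsetdist_lessI[where a\<^sub>0 = 0])
  have "v \<rightarrow>\<^sup>*\<^bsub>with_proj (star_graph n)\<^esub> 0"
    using assms by (intro star.reachable_tree) auto
  then show "vdist (star_graph n) v 0 < \<infinity>"
    by (rule star.vdist_less_infinity)
  have "vdist (star_graph n) v 0 < vdist (star_graph n) v b"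
    using assms \<open>v \<rightarrow>\<^sup>*\<^bsub>with_proj (star_graph n)\<^esub> 0\<close>
    by (intro star.vdist_cut_vertex_less[of v "{0, v}"]) (auto simp: parcs_parent_graph)
  then show "\<exists>a\<in>{0}. vdist (star_graph n) v a < vdist (star_graph n) v b'" if "b' \<in> {b}" for b'
    using that by simp
qed auto

lemma value_A_star_graph:
  assumes "1 \<le> n"
  shows "real n \<le> value_A (star_graph n) 1 {} {}"
proof (rule le_value_A_strategy[where P = "\<lambda>A B. A = {} \<or> 0 \<in> A" and Q = "\<lambda>A B. 0 \<in> A"])
  fix A B
  assume pos: "position (star_graph n) 1 1 A B" and "A = {} \<or> 0 \<in> A"
  then have A: "A = {0}"
    by (auto simp: position_def card_1_singleton_iff)
  then obtain b where b: "B = {b}" "b \<in> {..n}" "b \<noteq> 0"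
    using pos by (auto simp: position_def card_1_singleton_iff)
  have "real (card ({..n} - {b})) \<le> voronoi_score (star_graph n) A B"
    using star_graph_won b unfolding A by (intro card_le_voronoi_score) auto
  then show "real n \<le> voronoi_score (star_graph n) A B"
    using b by simp
next
  fix k :: nat and A B
  assume "k < 1" "position (star_graph n) k k A B"
  then have "A = {}" "B = {}"
    using position_empty_iff[of "star_graph n" k k A B] by auto
  then show "\<exists>v\<in>pverts (star_graph n) - (A \<union> B). 0 \<in> insert v A"
    by auto
qed (use assms in auto)

abbreviation path_graph :: "nat \<Rightarrow> nat pair_pre_digraph" where
  "path_graph n \<equiv> parent_graph {..n} 0 (\<lambda>i. i - 1)"

interpretation path: rooted_tree "{..n}" 0 "\<lambda>i. i - 1" id for n :: nat
  by unfold_locales auto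

lemma max_degree_path_graph:
  assumes "2 \<le> n"
  shows "max_degree (path_graph n) = 2"
proof (rule max_degree_eqI)
  have children: "path.children n u = (if u < n then {Suc u} else {})" for u
    unfolding path.children_def by auto
  show "out_degree (with_proj (path_graph n)) 1 = 2"
    using assms path.out_degree_tree[of 1 n] by (simp only: children) simp
  show "out_degree (with_proj (path_graph n)) v \<le> 2" if "v \<in> pverts (path_graph n)" for v
    using that path.out_degree_tree[of v n] by (simp only: children) simp
qed (use assms in auto)

lemma voronoi_ratio_star_graph:
  assumes "1 \<le> n"
  shows "1 - 1 / real n \<le> voronoi_ratio (star_graph n) 1"
proof -
  have "1 - 1 / real n \<le> real n / real (Suc n)"
    using assms by (simp add: field_simps)
  also have "\<dots> \<le> voronoi_ratio (star_graph n) 1"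
    using value_A_star_graph[OF assms] by (simp add: voronoi_ratio_def divide_right_mono)
  finally show ?thesis .
qed

lemma voronoi_ratio_path_graph:
  assumes "1 \<le> t"
  shows "1 / 2 \<le> voronoi_ratio (path_graph (2 * t - 1)) t"
  using path.rounds_le_value_A[of t "2 * t - 1"] assms
  by (simp add: voronoi_ratio_def field_simps)

section \<open>Combs\<close>

text \<open>
  \<open>vertex j x h\<close> is the vertex at distance \<open>x\<close> from the hub along ray \<open>j\<close> if \<open>h = 0\<close>, and the
  \<open>h\<close>-th vertex of the tooth attached there if \<open>h > 0\<close>.
\<close>

definition vertex :: "nat \<Rightarrow> nat \<Rightarrow> nat \<Rightarrow> nat" where
  "vertex j x h = prod_encode (j, prod_encode (x, h))"

definition ray :: "nat \<Rightarrow> nat" where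
  "ray v = fst (prod_decode v)"

definition pos :: "nat \<Rightarrow> nat" where
  "pos v = fst (prod_decode (snd (prod_decode v)))"

definition height :: "nat \<Rightarrow> nat" where
  "height v = snd (prod_decode (snd (prod_decode v)))"

lemma coordinates_vertex [simp]:
  "ray (vertex j x h) = j" "pos (vertex j x h) = x" "height (vertex j x h) = h"
  by (simp_all add: vertex_def ray_def pos_def height_def)

lemma vertex_coordinates: "vertex (ray v) (pos v) (height v) = v"
  by (simp add: vertex_def ray_def pos_def height_def)

lemma vertex_exhaust: obtains j x h where "v = vertex j x h"
  using vertex_coordinates by metis

lemma vertex_eq_iff [simp]: "vertex j x h = vertex j' x' h' \<longleftrightarrow> j = j' \<and> x = x' \<and> h = h'"
  by (simp add: vertex_def)

abbreviation hub :: nat where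
  "hub \<equiv> vertex 0 0 0"

definition spine :: "nat \<Rightarrow> nat \<Rightarrow> nat" where
  "spine j x = (if x = 0 then hub else vertex j x 0)"

lemma spine_0 [simp]: "spine j 0 = hub"
  by (simp add: spine_def)

lemma spine_eq_hub_iff [simp]: "spine j x = hub \<longleftrightarrow> x = 0"
  by (simp add: spine_def)

lemma pos_spine [simp]: "pos (spine j x) = x"
  by (simp add: spine_def)

lemma height_spine [simp]: "height (spine j x) = 0"
  by (simp add: spine_def)

definition parent :: "nat \<Rightarrow> nat" where
  "parent v = (if 0 < height v then vertex (ray v) (pos v) (height v - 1)
     else spine (ray v) (pos v - 1))"

lemma parent_vertex [simp]:
  "parent (vertex j x 0) = spine j (x - 1)"
  "parent (vertex j x (Suc h)) = vertex j x h"
  by (simp_all add: parent_def)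

locale comb =
  fixes \<Delta> t m N :: nat
  assumes degree_ge_3: "3 \<le> \<Delta>"
begin

definition foot :: "nat \<Rightarrow> nat" where
  "foot i = (t + 1) * 3 ^ i"

definition len :: nat where
  "len = foot m"

definition rays :: "nat set" where
  "rays = (\<lambda>(j, x). vertex j x 0) ` ({..<\<Delta>} \<times> {1..len})"

definition teeth :: "nat set" where
  "teeth = (\<lambda>(j, i, h). vertex j (foot i) h) ` ({..<\<Delta>} \<times> {..<m} \<times> {1..N})"

definition V :: "nat set" where
  "V = insert hub (rays \<union> teeth)"

lemma foot_gt: "t < foot i"
  using mult_le_mono2[of 1 "3 ^ i" "t + 1"] by (simp add: foot_def)

lemma foot_pos: "0 < foot i"
  by (simp add: foot_def)

lemma foot_mono: "i \<le> k \<Longrightarrow> foot i \<le> foot k"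
  unfolding foot_def by (intro mult_left_mono power_increasing) auto

lemma foot_Suc: "foot (Suc i) = 3 * foot i"
  by (simp add: foot_def)

lemma foot_le_len: "i < m \<Longrightarrow> foot i \<le> len"
  unfolding len_def by (intro foot_mono) simp

lemma len_pos: "0 < len"
  by (simp add: len_def foot_pos)

lemma inj_foot: "inj foot"
  by (simp add: inj_on_def foot_def del: mult_Suc)

lemma V_cases [consumes 1, case_names hub ray tooth]:
  assumes "v \<in> V"
  obtains "v = hub"
    | j x where "v = vertex j x 0" "j < \<Delta>" "1 \<le> x" "x \<le> len"
    | j i h where "v = vertex j (foot i) h" "j < \<Delta>" "i < m" "1 \<le> h" "h \<le> N"
  using assms by (auto simp: V_def rays_def teeth_def)

lemma ray_in_V: "j < \<Delta> \<Longrightarrow> 1 \<le> x \<Longrightarrow> x \<le> len \<Longrightarrow> vertex j x 0 \<in> V"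
  by (force simp: V_def rays_def)

lemma tooth_in_V: "j < \<Delta> \<Longrightarrow> i < m \<Longrightarrow> h \<le> N \<Longrightarrow> vertex j (foot i) h \<in> V"
  using ray_in_V[of j "foot i"] foot_gt[of i] foot_le_len[of i]
  by (cases "h = 0") (force simp: V_def teeth_def)+

lemma hub_in_V: "hub \<in> V"
  by (simp add: V_def)

lemma spine_in_V: "j < \<Delta> \<Longrightarrow> x \<le> len \<Longrightarrow> spine j x \<in> V"
  by (auto simp: spine_def hub_in_V intro: ray_in_V)

lemma V_nonhub:
  assumes "v \<in> V" "v \<noteq> hub"
  shows "ray v < \<Delta>" "0 < pos v"
  using assms foot_pos by (auto elim!: V_cases)

lemma card_V: "card V = 1 + \<Delta> * len + \<Delta> * m * N"
proof -
  have "card rays = \<Delta> * len"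
    unfolding rays_def by (subst card_image) (auto simp: inj_on_def card_cartesian_product)
  moreover have "card teeth = \<Delta> * m * N"
    unfolding teeth_def using inj_foot
    by (subst card_image) (auto simp: inj_on_def card_cartesian_product)
  moreover have "finite rays" "finite teeth" "rays \<inter> teeth = {}" "hub \<notin> rays \<union> teeth"
    by (auto simp: rays_def teeth_def)
  ultimately show ?thesis
    by (simp add: V_def card_Un_disjoint)
qed

lemma card_V_ge: "2 * t \<le> card V"
proof -
  have "2 * t \<le> \<Delta> * len"
    using degree_ge_3 foot_gt[of m] by (intro mult_mono) (auto simp: len_def)
  then show ?thesis by (simp add: card_V)
qed

sublocale rooted_tree V hub parent "\<lambda>v. pos v + height v"
proof
  show "finite V"
    by (simp add: V_def rays_def teeth_def)
  fix u
  assume u: "u \<in> V" "u \<noteq> hub"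
  then show "parent u \<in> V"
  proof (cases u rule: V_cases)
    case (tooth j i h)
    then show ?thesis
      using tooth_in_V by (cases h) auto
  qed (auto intro: spine_in_V)
  show "pos (parent u) + height (parent u) < pos u + height u"
    using V_nonhub[OF u] by (auto simp: parent_def)
qed (rule hub_in_V)

lemma children_hub: "children hub = (\<lambda>j. vertex j 1 0) ` {..<\<Delta>}"
proof (intro equalityI subsetI)
  fix v
  assume "v \<in> children hub"
  then have v: "v \<in> V" "v \<noteq> hub" "parent v = hub"
    by (auto simp: children_def)
  then have "height v = 0" "pos v = 1"
    using V_nonhub(2)[of v] by (auto simp: parent_def split: if_splits)
  then have "v = vertex (ray v) 1 0"
    by (metis vertex_coordinates)
  then show "v \<in> (\<lambda>j. vertex j 1 0) ` {..<\<Delta>}"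
    using V_nonhub(1)[of v] v by blast
qed (use len_pos in \<open>auto simp: children_def intro: ray_in_V\<close>)

lemma children_nonhub:
  assumes "u \<noteq> hub"
  shows "children u \<subseteq> {vertex (ray u) (pos u + 1) 0, vertex (ray u) (pos u) (height u + 1)}"
proof
  fix v
  assume "v \<in> children u"
  then have v: "v \<in> V" "v \<noteq> hub" "u = parent v"
    by (auto simp: children_def)
  obtain j x h where vertex: "v = vertex j x h"
    by (rule vertex_exhaust)
  show "v \<in> {vertex (ray u) (pos u + 1) 0, vertex (ray u) (pos u) (height u + 1)}"
    using V_nonhub(2)[OF v(1,2)] v(3) assms unfolding vertex
    by (cases h) (auto simp: spine_def split: if_splits)
qed

lemma max_degree_comb: "max_degree G = \<Delta>"
proof (rule max_degree_eqI)
  show hub: "out_degree (with_proj G) hub = \<Delta>"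
    by (simp add: out_degree_tree hub_in_V children_hub card_image inj_on_def)
  fix u
  assume u: "u \<in> pverts G"
  show "out_degree (with_proj G) u \<le> \<Delta>"
  proof (cases "u = hub")
    case False
    have "card (children u) \<le> 2"
      using card_mono[OF _ children_nonhub[OF False]] by (simp add: card_insert_if split: if_splits)
    then show ?thesis
      using u False degree_ge_3 by (simp add: out_degree_tree)
  qed (simp add: hub)
qed (use hub_in_V finite_V in auto)

lemma vdist_spine_less:
  assumes "v \<in> V" "ray v = j" "a < pos v"
    and "w \<noteq> spine j a" "\<not> (ray w = j \<and> a < pos w)" "spine j a \<in> V"
  shows "vdist G v (spine j a) < vdist G v w"
proof (rule vdist_cut_vertex_less)
  let ?S = "insert (spine j a) {u. ray u = j \<and> a < pos u}"
  show "v \<in> ?S" "w \<notin> ?S" using assms by auto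
  show "v \<rightarrow>\<^sup>*\<^bsub>with_proj G\<^esub> spine j a"
    using assms by (intro reachable_tree)
  have up: "parent u \<in> ?S" if "u \<in> ?S" "u \<noteq> spine j a" for u
    using that by (auto simp: parent_def spine_def not_less_eq less_Suc_eq)
  have down: "u \<in> ?S" if "parent u \<in> ?S" "parent u \<noteq> spine j a" for u
    using that by (auto simp: parent_def spine_def split: if_splits)
  fix x y
  assume "(x, y) \<in> parcs G" "x \<in> ?S" "y \<notin> ?S"
  then show "x = spine j a"
    using up[of x] down[of y] by (auto simp: parcs_parent_graph)
qed

lemma vdist_hub_less:
  assumes "vertex j x h \<in> V" "2 * x < pos b"
  shows "vdist G (vertex j x h) hub < vdist G (vertex j x h) b"
proof -
  \<comment> \<open>Minus the height on the teeth attached at \<open>x\<close>, hence \<open>\<phi> (vertex j x h) = - h\<close>.\<close>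
  define \<phi> where "\<phi> u = real (pos u) - real x - (if pos u = x then real (height u) else 0)" for u
  have "\<bar>\<phi> u - \<phi> (parent u)\<bar> \<le> 1" if "u \<in> V" "u \<noteq> hub" for u
  proof -
    obtain j x h where u: "u = vertex j x h"
      by (rule vertex_exhaust)
    show ?thesis
      using V_nonhub(2)[OF that] unfolding u by (cases h) (auto simp: \<phi>_def)
  qed
  then have "ereal (\<phi> b - \<phi> (vertex j x h)) \<le> vdist G (vertex j x h) b"
    by (rule potential_le_vdist_tree)
  moreover have "vdist G (vertex j x h) hub \<le> ereal (x + h)"
    using vdist_root_le_depth[OF assms(1)] by simp
  moreover have "ereal (x + h) < ereal (\<phi> b - \<phi> (vertex j x h))"
    using assms(2) by (simp add: \<phi>_def)
  ultimately show ?thesis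
    by (meson order_le_less_trans order_less_le_trans)
qed

\<comment> \<open>Claims near the end of a ray lie beyond every window below and need no answer.\<close>
definition answered :: "nat set \<Rightarrow> nat \<Rightarrow> bool" where
  "answered A b \<longleftrightarrow> (pos b + t \<le> len \<longrightarrow> (\<exists>x\<in>{pos b..pos b + t}. spine (ray b) x \<in> A))"

lemma answered_insert: "answered A b \<Longrightarrow> answered (insert v A) b"
  by (auto simp: answered_def)

\<comment> \<open>A claim beyond \<open>window i\<close> loses the \<open>i\<close>-th tooth to the hub, an answered claim before it loses
  that tooth to the answer.\<close>
definition window :: "nat \<Rightarrow> nat set" where
  "window i = {foot i - t..2 * foot i}"

lemma window_disjoint:
  assumes "x \<in> window i" "x \<in> window k"
  shows "i = k"
proof -
  have "False" if "i < k" "x \<in> window i" "x \<in> window k" for i k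
  proof -
    have "3 * foot i \<le> foot k"
      using foot_mono[of "Suc i" k] that(1) by (simp add: foot_Suc)
    then show False
      using that foot_gt[of i] by (auto simp: window_def)
  qed
  then show ?thesis
    using assms by (metis linorder_neqE_nat)
qed

lemma closer_claim_exists:
  assumes v: "vertex j (foot i) h \<in> V" "i < m" and A: "hub \<in> A" "A \<subseteq> V" "b \<notin> A"
    and answered: "ray b = j \<Longrightarrow> answered A b \<and> pos b \<notin> window i"
  shows "\<exists>a\<in>A. vdist G (vertex j (foot i) h) a < vdist G (vertex j (foot i) h) b"
proof -
  consider (other_ray) "ray b \<noteq> j" | (beyond) "2 * foot i < pos b"
    | (before) "ray b = j" "pos b + t < foot i"
    using answered by (force simp: window_def)
  then show ?thesis
  proof cases
    case other_ray
    then have "vdist G (vertex j (foot i) h) (spine j 0) < vdist G (vertex j (foot i) h) b"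
      using v(1) A foot_gt[of i] hub_in_V by (intro vdist_spine_less) auto
    with A(1) show ?thesis by auto
  next
    case beyond
    with v(1) A(1) show ?thesis
      using vdist_hub_less by blast
  next
    case before
    then obtain x where x: "pos b \<le> x" "x \<le> pos b + t" "spine j x \<in> A"
      using answered foot_le_len[OF v(2)] by (auto simp: answered_def)
    then have "vdist G (vertex j (foot i) h) (spine j x) < vdist G (vertex j (foot i) h) b"
      using before v(1) A by (intro vdist_spine_less) auto
    with x(3) show ?thesis by blast
  qed
qed

lemma tooth_won:
  assumes "j < \<Delta>" "i < m" "h \<le> N" "position G k l A B" "hub \<in> A"
    and "\<And>b. b \<in> B \<Longrightarrow> ray b = j \<Longrightarrow> answered A b \<and> pos b \<notin> window i"
  shows "vsetdist G (vertex j (foot i) h) A < vsetdist G (vertex j (foot i) h) B"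
proof (rule vsetdist_lessI[where a\<^sub>0 = hub])
  have v: "vertex j (foot i) h \<in> V"
    using assms(1-3) by (rule tooth_in_V)
  show "finite B" using assms(4) by (rule position_finite)
  show "vdist G (vertex j (foot i) h) hub < \<infinity>"
    using v hub_in_V by (intro vdist_less_infinity reachable_tree)
  show "\<exists>a\<in>A. vdist G (vertex j (foot i) h) a < vdist G (vertex j (foot i) h) b" if "b \<in> B" for b
    using v assms(2,4-6) that by (intro closer_claim_exists) (auto simp: position_def)
qed fact

definition threatened :: "nat set \<Rightarrow> (nat \<times> nat) set" where
  "threatened B = {(j, i). \<exists>b\<in>B. ray b = j \<and> pos b \<in> window i}"

lemma card_threatened_le:
  assumes "finite B"
  shows "finite (threatened B)" "card (threatened B) \<le> card B"
proof -
  have sub: "threatened B \<subseteq> (\<lambda>b. (ray b, THE i. pos b \<in> window i)) ` B"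
  proof
    fix q
    assume "q \<in> threatened B"
    then obtain b i where b: "q = (ray b, i)" "b \<in> B" "pos b \<in> window i"
      by (auto simp: threatened_def)
    moreover from this have "(THE i. pos b \<in> window i) = i"
      by (intro the_equality) (auto intro: window_disjoint)
    ultimately show "q \<in> (\<lambda>b. (ray b, THE i. pos b \<in> window i)) ` B"
      by blast
  qed
  show "finite (threatened B)"
    using sub assms by (auto intro: finite_subset)
  show "card (threatened B) \<le> card B"
    using assms sub by (rule surj_card_le)
qed

lemma card_teeth_le_voronoi_score:
  assumes "T \<subseteq> {..<\<Delta>} \<times> {..<m}"
    and won: "\<And>j i h. (j, i) \<in> T \<Longrightarrow> h \<le> N \<Longrightarrow>
      vsetdist G (vertex j (foot i) h) A < vsetdist G (vertex j (foot i) h) B"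
  shows "real (card T) * real N \<le> voronoi_score G A B"
proof -
  let ?S = "(\<lambda>((j, i), h). vertex j (foot i) h) ` (T \<times> {1..N})"
  have "inj_on (\<lambda>((j, i), h). vertex j (foot i) h) (T \<times> {1..N})"
    using inj_foot by (auto simp: inj_on_def)
  then have "real (card T) * real N = real (card ?S)"
    by (simp add: card_image card_cartesian_product)
  also have "\<dots> \<le> voronoi_score G A B"
    using assms finite_V by (intro card_le_voronoi_score) (auto intro!: tooth_in_V)
  finally show ?thesis .
qed

lemma voronoi_score_ge:
  assumes "position G l k A B" "hub \<in> A"
    and answered: "\<And>b. b \<in> B \<Longrightarrow> b \<noteq> b\<^sub>0 \<Longrightarrow> answered A b"
  shows "(real (\<Delta> - 1) * real m - real k) * real N \<le> voronoi_score G A B"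
proof -
  define T where "T = ({..<\<Delta>} - {ray b\<^sub>0}) \<times> {..<m} - threatened B"
  have B: "finite B" "card B = k"
    using assms(1) position_finite[OF assms(1)] by (auto simp: position_def)
  have "\<Delta> - 1 \<le> card ({..<\<Delta>} - {ray b\<^sub>0})"
    using diff_card_le_card_Diff[of "{ray b\<^sub>0}" "{..<\<Delta>}"] by simp
  then have "(\<Delta> - 1) * m \<le> card (({..<\<Delta>} - {ray b\<^sub>0}) \<times> {..<m})"
    by (simp add: card_cartesian_product)
  also have "\<dots> \<le> card T + k"
    using diff_card_le_card_Diff[OF card_threatened_le(1), of B] card_threatened_le(2)[of B] B
    unfolding T_def by (meson le_diff_conv le_trans add_left_mono)
  finally have "real (\<Delta> - 1) * real m - real k \<le> real (card T)"
    by (metis diff_le_eq of_nat_add of_nat_le_iff of_nat_mult)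
  then have "(real (\<Delta> - 1) * real m - real k) * real N \<le> real (card T) * real N"
    by (rule mult_right_mono) simp
  also have "\<dots> \<le> voronoi_score G A B"
  proof (rule card_teeth_le_voronoi_score)
    fix j i h
    assume T: "(j, i) \<in> T" "h \<le> N"
    show "vsetdist G (vertex j (foot i) h) A < vsetdist G (vertex j (foot i) h) B"
    proof (rule tooth_won[OF _ _ _ assms(1,2)])
      show "answered A b \<and> pos b \<notin> window i" if "b \<in> B" "ray b = j" for b
        using that T(1) answered[of b] by (auto simp: T_def threatened_def)
    qed (use T in \<open>auto simp: T_def\<close>)
  qed (auto simp: T_def)
  finally show ?thesis .
qed

lemma answer_exists:
  assumes "position G l k A B" "k \<le> t" "b \<in> V" "b \<noteq> hub" "\<not> answered A b"
  shows "\<exists>v\<in>V - (A \<union> B). answered (insert v A) b"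
proof -
  let ?R = "spine (ray b) ` {pos b..pos b + t}"
  have "inj_on (spine (ray b)) {pos b..pos b + t}"
    by (metis inj_onI pos_spine)
  then have "card B < card ?R"
    using assms(1,2) by (simp add: card_image position_def)
  then have "\<not> ?R \<subseteq> B"
    using card_mono[OF position_finite(2)[OF assms(1)], of ?R] by linarith
  then obtain x where x: "x \<in> {pos b..pos b + t}" "spine (ray b) x \<notin> B"
    by blast
  have "pos b + t \<le> len" "spine (ray b) x \<notin> A"
    using assms(5) x(1) by (auto simp: answered_def)
  then have "spine (ray b) x \<in> V - (A \<union> B)"
    using V_nonhub(1)[OF assms(3,4)] x by (auto intro: spine_in_V)
  moreover have "answered (insert (spine (ray b) x) A) b"
    using x(1) by (auto simp: answered_def)
  ultimately show ?thesis ..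
qed

definition defended :: "nat set \<Rightarrow> nat set \<Rightarrow> bool" where
  "defended A B \<longleftrightarrow> hub \<in> A \<and> (\<forall>b\<in>B. answered A b)"

definition defended_but_one :: "nat set \<Rightarrow> nat set \<Rightarrow> bool" where
  "defended_but_one A B \<longleftrightarrow> hub \<in> A \<and> (\<exists>b\<^sub>0. \<forall>b\<in>B - {b\<^sub>0}. answered A b)"

lemma defended_insert: "defended A B \<Longrightarrow> defended_but_one A (insert v B)"
  by (auto simp: defended_def defended_but_one_def)

lemma defending_claim_exists:
  assumes pos: "position G k k A B" and "k < t" and "defended_but_one A B"
  shows "\<exists>v\<in>V - (A \<union> B). defended (insert v A) B"
proof -
  obtain b\<^sub>0 where b\<^sub>0: "\<And>b. b \<in> B \<Longrightarrow> b \<noteq> b\<^sub>0 \<Longrightarrow> answered A b" and "hub \<in> A"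
    using assms(3) by (auto simp: defended_but_one_def)
  have "\<exists>v\<in>V - (A \<union> B). b\<^sub>0 \<in> B \<longrightarrow> answered (insert v A) b\<^sub>0"
  proof (cases "b\<^sub>0 \<in> B \<and> \<not> answered A b\<^sub>0")
    case True
    moreover from this have "b\<^sub>0 \<in> V" "b\<^sub>0 \<noteq> hub"
      using pos \<open>hub \<in> A\<close> by (auto simp: position_def)
    ultimately show ?thesis
      using answer_exists[OF pos] assms(2) by auto
  next
    case False
    moreover have "\<not> V \<subseteq> A \<union> B"
      using position_not_full[OF pos] card_V_ge assms(2) by simp
    ultimately show ?thesis
      using answered_insert by blast
  qed
  then obtain v where v: "v \<in> V - (A \<union> B)" "b\<^sub>0 \<in> B \<longrightarrow> answered (insert v A) b\<^sub>0"
    by blast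
  then have "defended (insert v A) B"
    using b\<^sub>0 answered_insert \<open>hub \<in> A\<close> unfolding defended_def by blast
  with v(1) show ?thesis by blast
qed

lemma value_A_ge:
  assumes "1 \<le> t"
  shows "(real (\<Delta> - 1) * real m - real t) * real N \<le> value_A G t {} {}"
proof (rule le_value_A_strategy[where Q = defended and
      P = "\<lambda>A B. A = {} \<or> defended_but_one A B"])
  fix k A B
  assume k: "k < t" and pos: "position G k k A B" and P: "A = {} \<or> defended_but_one A B"
  show "\<exists>v\<in>pverts G - (A \<union> B). defended (insert v A) B"
  proof (cases "A = {}")
    case True
    then have "B = {}"
      using position_empty_iff[OF pos] by simp
    with True show ?thesis
      using hub_in_V by (auto simp: defended_def)
  next
    case False
    then show ?thesis
      using defending_claim_exists[OF pos k] P by simp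
  qed
next
  fix A B
  assume pos: "position G t t A B" and "A = {} \<or> defended_but_one A B"
  then have "defended_but_one A B"
    using position_empty_iff(1)[OF pos] assms by auto
  then show "(real (\<Delta> - 1) * real m - real t) * real N \<le> voronoi_score G A B"
    using voronoi_score_ge[OF pos] by (auto simp: defended_but_one_def)
qed (use finite_V card_V_ge defended_insert in auto)

lemma voronoi_ratio_ge:
  assumes "1 \<le> t" "1 + \<Delta> * len \<le> N"
  shows "(real (\<Delta> - 1) * real m - real t) / (1 + real \<Delta> * real m) \<le> voronoi_ratio G t"
proof (cases "0 \<le> real (\<Delta> - 1) * real m - real t")
  case True
  have "card V \<le> (1 + \<Delta> * m) * N"
    using assms(2) by (simp add: card_V algebra_simps)
  then have "real (card V) \<le> real ((1 + \<Delta> * m) * N)"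
    by (rule of_nat_mono)
  then have card: "real (card V) \<le> (1 + real \<Delta> * real m) * real N"
    by (simp only: of_nat_mult of_nat_add of_nat_1)
  have "0 < N" "0 < card V"
    using assms(2) by (simp_all add: card_V)
  then have "(real (\<Delta> - 1) * real m - real t) / (1 + real \<Delta> * real m) =
      (real (\<Delta> - 1) * real m - real t) * real N / ((1 + real \<Delta> * real m) * real N)"
    by simp
  also have "\<dots> \<le> value_A G t {} {} / real (card V)"
    using True card \<open>0 < card V\<close> value_A_ge[OF assms(1)]
    by (intro frac_le) (auto simp: value_nonneg finite_V)
  finally show ?thesis
    by (simp add: voronoi_ratio_def)
next
  case False
  then have "(real (\<Delta> - 1) * real m - real t) / (1 + real \<Delta> * real m) \<le> 0"
    by (intro divide_nonpos_nonneg) auto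
  also have "\<dots> \<le> voronoi_ratio G t"
    using finite_V by (intro voronoi_ratio_nonneg) simp
  finally show ?thesis .
qed

end

abbreviation comb_graph :: "nat \<Rightarrow> nat \<Rightarrow> nat \<Rightarrow> nat \<Rightarrow> nat pair_pre_digraph" where
  "comb_graph \<Delta> t m N \<equiv> parent_graph (comb.V \<Delta> t m N) hub parent"

lemma tendsto_linear_fraction:
  fixes a b c :: real
  assumes "0 < c"
  shows "(\<lambda>m. (a * real m - b) / (1 + c * real m)) \<longlonglongrightarrow> a / c"
  using assms by real_asymp (simp add: divide_inverse)

lemma exists_comb_voronoi_ratio_ge:
  assumes "3 \<le> \<Delta>" "1 \<le> t" "0 < \<epsilon>"
  obtains m N where "1 - 1 / real \<Delta> - \<epsilon> \<le> voronoi_ratio (comb_graph \<Delta> t m N) t"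
proof -
  have "real (\<Delta> - 1) / real \<Delta> = 1 - 1 / real \<Delta>"
    using assms(1) by (simp add: of_nat_diff diff_divide_distrib)
  then have "(\<lambda>m. (real (\<Delta> - 1) * real m - real t) / (1 + real \<Delta> * real m))
      \<longlonglongrightarrow> 1 - 1 / real \<Delta>"
    using tendsto_linear_fraction[of "real \<Delta>" "real (\<Delta> - 1)" "real t"] assms(1) by simp
  from order_tendstoD(1)[OF this, of "1 - 1 / real \<Delta> - \<epsilon>"] obtain m where
    m: "1 - 1 / real \<Delta> - \<epsilon> < (real (\<Delta> - 1) * real m - real t) / (1 + real \<Delta> * real m)"
    using assms(3) by (auto simp: eventually_sequentially)
  define N where "N = 1 + \<Delta> * comb.len t m"
  interpret comb \<Delta> t m N
    using assms(1) by unfold_locales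
  have "1 - 1 / real \<Delta> - \<epsilon> \<le> voronoi_ratio (comb_graph \<Delta> t m N) t"
    using m voronoi_ratio_ge[OF assms(2)] by (simp add: N_def)
  then show ?thesis by (rule that)
qed

theorem theorem5:
  fixes \<Delta> t :: nat and \<epsilon> :: real
  assumes "\<Delta> \<ge> 1" and "t \<ge> 1" and "\<epsilon> > 0"
  shows "\<exists>G :: nat pair_pre_digraph.
           pair_graph G \<and> Digraph_Component.connected (with_proj G) \<and> max_degree G = \<Delta> \<and>
           (\<Delta> \<ge> 2 \<longrightarrow> 2 * t \<le> card (pverts G)) \<and>
           voronoi_ratio G t \<ge> 1 - 1 / real \<Delta> - \<epsilon>"
proof -
  consider (star) "\<Delta> = 1 \<or> t = 1" | (path) "\<Delta> = 2" "t \<ge> 2" | (comb) "\<Delta> \<ge> 3"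
    using assms by linarith
  then show ?thesis
  proof cases
    case star
    then have "1 - 1 / real \<Delta> - \<epsilon> \<le> voronoi_ratio (star_graph \<Delta>) t"
      using voronoi_ratio_star_graph[OF assms(1)] voronoi_ratio_nonneg[of "star_graph \<Delta>" t] assms(3)
      by auto
    with star show ?thesis
      using star.pair_graph_tree star.connected_tree max_degree_star_graph
      by (intro exI[of _ "star_graph \<Delta>"]) auto
  next
    case path
    then show ?thesis
      using path.pair_graph_tree path.connected_tree max_degree_path_graph[of "2 * t - 1"]
        voronoi_ratio_path_graph[OF assms(2)] assms(3)
      by (intro exI[of _ "path_graph (2 * t - 1)"]) auto
  next
    case comb
    then obtain m N where ratio: "1 - 1 / real \<Delta> - \<epsilon> \<le> voronoi_ratio (comb_graph \<Delta> t m N) t"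
      using exists_comb_voronoi_ratio_ge assms(2,3) by blast
    interpret comb \<Delta> t m N
      using comb by unfold_locales
    show ?thesis
      using pair_graph_tree connected_tree max_degree_comb card_V_ge ratio
      by (intro exI[of _ "comb_graph \<Delta> t m N"]) auto
  qed
qed

end
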